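(* There exists no $(1-o(1))$-competitive algorithm for threshold testing. That is, there is no testing algorithm (defined for every number $n$ of boxes) together with a function $\varepsilon(n)\to0$ such that for every distribution $F$ on $\mathbb{R}_{\ge0}$ with finite expectation and every $n$, $\mathbb{E}[X_\sigma]\ge (1-\varepsilon(n))\cdot\mathbb{E}[\max\{X_1,\dots,X_n\}]$, where $X_1,\dots,X_n$ are i.i.d.\ with distribution $F$ and $\sigma$ is the box chosen by the algorithm.
   Context: Threshold testing: A distribution $F$ on $\mathbb{R}_{\ge0}$ with finite expectation is known. There are $n$ boxes; box $i$ contains a hidden value $X_i$, where $X_1,\dots,X_n$ are drawn once upfront i.i.d.\ from $F$. A testing algorithm tests each box exactly once, in the order $1,2,\dots,n$: to test box $i$ it chooses a threshold $t_i\ge 0$ and learns only whether $X_i\ge t_i$ (positive test) or not (negative test). Thresholds may be chosen adaptively depending on earlier outcomes (and internal randomness). After all tests, the algorithm chooses a box $\sigma$ based on the observed feedback and receives $X_\sigma$. An algorithm is $c$-competitive if $\mathbb{E}[X_\sigma]\ge c\cdot\mathbb{E}[\max\{X_1,\dots,X_n\}]$. *)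

theory Defs
  imports "HOL-Probability.Probability"
begin

definition nonneg_distribution :: "real measure \<Rightarrow> bool" where
  "nonneg_distribution F \<longleftrightarrow>
     real_distribution F \<and> (AE x in F. 0 \<le> x) \<and> integrable F (\<lambda>x. x)"

text \<open>
  Boxes are indexed by 0, ..., n - 1. All internal randomness is contained in one seed, drawn from
  an arbitrary probability space independently of the values. A list of outcomes (True for
  a positive test) is in chronological order, so the threshold for box i is obtained from a list of
  length i, and the chosen box from a list of length n.
\<close>

record 'r testing_algorithm =
  seed_space :: "'r measure"
  threshold :: "'r \<Rightarrow> bool list \<Rightarrow> real"
  choice :: "'r \<Rightarrow> bool list \<Rightarrow> nat"

text \<open>
  Measurability in the seed is what makes the reward a random variable; there are only finitely many
  outcome lists of each length, so nothing more is needed.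
\<close>

definition is_testing_algorithm :: "nat \<Rightarrow> 'r testing_algorithm \<Rightarrow> bool" where
  "is_testing_algorithm n A \<longleftrightarrow>
     prob_space (seed_space A) \<and>
     (\<forall>h. length h < n \<longrightarrow>
        (\<lambda>s. threshold A s h) \<in> borel_measurable (seed_space A) \<and>
        (\<forall>s\<in>space (seed_space A). 0 \<le> threshold A s h)) \<and>
     (\<forall>h. length h = n \<longrightarrow>
        (\<lambda>s. choice A s h) \<in> measurable (seed_space A) (count_space {..<n}))"

primrec outcomes :: "'r testing_algorithm \<Rightarrow> 'r \<Rightarrow> (nat \<Rightarrow> real) \<Rightarrow> nat \<Rightarrow> bool list" where
  "outcomes A s x 0 = []"
| "outcomes A s x (Suc i) =
     outcomes A s x i @ [x i \<ge> threshold A s (outcomes A s x i)]"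

definition chosen_box :: "'r testing_algorithm \<Rightarrow> nat \<Rightarrow> 'r \<Rightarrow> (nat \<Rightarrow> real) \<Rightarrow> nat" where
  "chosen_box A n s x = choice A s (outcomes A s x n)"

definition iid_values :: "nat \<Rightarrow> real measure \<Rightarrow> (nat \<Rightarrow> real) measure" where
  "iid_values n F = PiM {..<n} (\<lambda>_. F)"

definition expected_reward :: "nat \<Rightarrow> real measure \<Rightarrow> 'r testing_algorithm \<Rightarrow> real" where
  "expected_reward n F A =
     (LINT (s, x)|(seed_space A \<Otimes>\<^sub>M iid_values n F). x (chosen_box A n s x))"

definition expected_max :: "nat \<Rightarrow> real measure \<Rightarrow> real" where
  "expected_max n F = (LINT x|iid_values n F. Max (x ` {..<n}))"

definition competitive :: "real \<Rightarrow> nat \<Rightarrow> real measure \<Rightarrow> 'r testing_algorithm \<Rightarrow> bool" where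
  "competitive c n F A \<longleftrightarrow> expected_reward n F A \<ge> c * expected_max n F"

end

theory Submission
  imports Defs
begin

text \<open>
  Let 1, 2, 3 have probability \<open>1/n\<close> each and 0 the rest, with \<open>n = 4 m\<close>. Fix the seed, and let
  \<open>t\<close> be the threshold used for box \<open>i\<close> when all earlier values are 0. If \<open>t\<close> does not separate 0
  from 1, a single 1 in box \<open>i\<close> is overlooked, and the algorithm chooses the same box as for the zero
  vector. Otherwise \<open>t\<close> does not separate 1 from 3; if the only other nonzero value is a 2 in a later
  box, the algorithm errs either when box \<open>i\<close> contains 1 or when it contains 3. One of the two cases
  occurs for at least half of the boxes in the first half, so that a loss of at least 1 happens with
  probability bounded below by a constant, while the expected maximum is at most 3.
\<close>

section \<open>Feedback histories\<close>

text \<open>Tests are compared only at the thresholds met in the run on \<open>x\<close>: by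
  induction the histories agree so far, so the run on \<open>y\<close> meets the same
  thresholds.\<close>

lemma outcomes_cong:
  assumes "\<And>k. k < m \<Longrightarrow>
    x k \<ge> threshold A s (outcomes A s x k) \<longleftrightarrow> y k \<ge> threshold A s (outcomes A s x k)"
  shows "outcomes A s x m = outcomes A s y m"
  using assms
proof (induction m)
  case (Suc m)
  then have "outcomes A s x m = outcomes A s y m" by simp
  with Suc.prems[of m] show ?case by simp
qed simp

lemma length_outcomes [simp]: "length (outcomes A s x m) = m"
  by (induction m) auto

lemma choice_less:
  assumes "is_testing_algorithm n A" "s \<in> space (seed_space A)" "length h = n"
  shows "choice A s h < n"
proof -
  have "(\<lambda>s. choice A s h) \<in> measurable (seed_space A) (count_space {..<n})"
    using assms by (simp add: is_testing_algorithm_def)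
  from measurable_space[OF this assms(2)] show ?thesis by simp
qed

section \<open>The hard distribution\<close>

text \<open>Indices 0, 1, 2 stand for the three rare values, so that pushing forward the uniform law
  on \<open>{..<n}\<close> turns point masses into counts.\<close>

definition hard_value :: "nat \<Rightarrow> real" where
  "hard_value k = (if k < 3 then real k + 1 else 0)"

definition hard_distr :: "nat \<Rightarrow> real measure" where
  "hard_distr n = distr (measure_pmf (pmf_of_set {..<n})) borel hard_value"

lemma real_distribution_hard_distr: "real_distribution (hard_distr n)"
  unfolding hard_distr_def real_distribution_def real_distribution_axioms_def
  by (auto intro!: prob_space.prob_space_distr prob_space_measure_pmf)

lemma space_hard_distr [simp]: "space (hard_distr n) = UNIV"
  and sets_hard_distr [measurable_cong, simp]: "sets (hard_distr n) = sets borel"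
  by (simp_all add: hard_distr_def)

lemma prob_space_hard_distr: "prob_space (hard_distr n)"
  using real_distribution_hard_distr real_distribution_def by blast

lemma AE_hard_distr: "AE x in hard_distr n. 0 \<le> x \<and> x \<le> 3"
  unfolding hard_distr_def by (subst AE_distr_iff) (auto simp: hard_value_def)

lemma nonneg_distribution_hard_distr: "nonneg_distribution (hard_distr n)"
proof -
  interpret prob_space "hard_distr n" by (rule prob_space_hard_distr)
  have "integrable (hard_distr n) (\<lambda>x. x)"
  proof (rule integrable_const_bound)
    show "AE x in hard_distr n. norm x \<le> 3" using AE_hard_distr by eventually_elim auto
  qed simp
  then show ?thesis
    using AE_hard_distr real_distribution_hard_distr by (auto simp: nonneg_distribution_def)
qed

lemma measure_hard_distr:
  assumes "3 \<le> n"
  shows "a \<in> {1, 2, 3} \<Longrightarrow> measure (hard_distr n) {a} = 1 / real n"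
    and "measure (hard_distr n) {0} = 1 - 3 / real n"
proof -
  have *: "measure (hard_distr n) {b} = real (card ({..<n} \<inter> hard_value -` {b})) / real n" for b
    using assms unfolding hard_distr_def
    by (subst measure_distr) (auto simp: measure_pmf_of_set lessThan_empty_iff)
  show "measure (hard_distr n) {a} = 1 / real n" if "a \<in> {1, 2, 3}"
  proof -
    from that have "\<exists>k<3. a = real k + 1"
      by (auto intro: exI[of _ "0::nat"] exI[of _ "1::nat"] exI[of _ "2::nat"])
    then obtain k :: nat where k: "k < 3" "a = real k + 1" by blast
    then have "{..<n} \<inter> hard_value -` {a} = {k}"
      using assms by (auto simp: hard_value_def split: if_splits)
    then show ?thesis by (simp add: *)
  qed
  have "{..<n} \<inter> hard_value -` {0} = {3..<n}"
    by (auto simp: hard_value_def split: if_splits)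
  then show "measure (hard_distr n) {0} = 1 - 3 / real n"
    using assms by (simp add: * field_simps of_nat_diff)
qed

section \<open>I.i.d. samples and their maximum\<close>

lemma space_iid_hard [simp]: "space (iid_values n (hard_distr n)) = {..<n} \<rightarrow>\<^sub>E UNIV"
  by (simp add: iid_values_def space_PiM)

lemma prob_space_iid_hard: "prob_space (iid_values n (hard_distr n))"
  unfolding iid_values_def by (intro prob_space_PiM prob_space_hard_distr)

text \<open>Seeing a point as a product of points makes its probability a product of point
  masses.\<close>

lemma singleton_eq_PiE: "c \<in> I \<rightarrow>\<^sub>E UNIV \<Longrightarrow> {c} = (\<Pi>\<^sub>E i\<in>I. {c i})"
  by (auto simp: PiE_eq_singleton PiE_iff extensional_def fun_eq_iff) metis

lemma sets_iid_hard_singleton: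
  assumes "c \<in> {..<n} \<rightarrow>\<^sub>E UNIV"
  shows "{c} \<in> sets (iid_values n (hard_distr n))"
  unfolding singleton_eq_PiE[OF assms] iid_values_def by (intro sets_PiM_I_finite) auto

lemma measure_iid_hard_singleton:
  assumes "c \<in> {..<n} \<rightarrow>\<^sub>E UNIV"
  shows "measure (iid_values n (hard_distr n)) {c} = (\<Prod>i<n. measure (hard_distr n) {c i})"
proof -
  interpret product_prob_space "\<lambda>_. hard_distr n" "{..<n}"
    by (simp add: product_prob_space_def product_prob_space_axioms_def product_sigma_finite_def
        prob_space_hard_distr prob_space_imp_sigma_finite)
  interpret finite_product_prob_space "\<lambda>_. hard_distr n" "{..<n}"
    by unfold_locales auto
  show ?thesis
    unfolding singleton_eq_PiE[OF assms] iid_values_def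
    by (subst finite_measure_PiM_emb[symmetric] | subst measure_times | simp)+
qed

lemma AE_iid_hard: "AE x in iid_values n (hard_distr n). \<forall>i<n. 0 \<le> x i \<and> x i \<le> 3"
proof -
  have "AE x in iid_values n (hard_distr n). \<forall>i\<in>{..<n}. 0 \<le> x i \<and> x i \<le> 3"
    unfolding iid_values_def
    by (intro AE_finite_allI AE_PiM_component prob_space_hard_distr AE_hard_distr) auto
  then show ?thesis by (simp only: Ball_def lessThan_iff)
qed

lemma AE_Max_iid_hard:
  assumes "0 < n"
  shows "AE x in iid_values n (hard_distr n). 0 \<le> Max (x ` {..<n}) \<and> Max (x ` {..<n}) \<le> 3"
  using AE_iid_hard
proof eventually_elim
  case (elim x)
  with assms have "0 \<le> x 0" "x 0 \<in> x ` {..<n}" by auto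
  then have "0 \<le> Max (x ` {..<n})"
    by (meson Max_ge finite_imageI finite_lessThan order_trans)
  then show ?case using elim assms by (subst Max_le_iff) (auto simp: lessThan_empty_iff)
qed

lemma integrable_Max_iid_hard:
  assumes "0 < n"
  shows "integrable (iid_values n (hard_distr n)) (\<lambda>x. Max (x ` {..<n}))"
proof -
  interpret prob_space "iid_values n (hard_distr n)" by (rule prob_space_iid_hard)
  show ?thesis
  proof (rule integrable_const_bound)
    show "AE x in iid_values n (hard_distr n). norm (Max (x ` {..<n})) \<le> 3"
      using AE_Max_iid_hard[OF assms] by eventually_elim auto
    show "(\<lambda>x. Max (x ` {..<n})) \<in> borel_measurable (iid_values n (hard_distr n))"
      unfolding iid_values_def by (rule borel_measurable_Max) auto
  qed
qed

lemma expected_max_hard_le: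
  assumes "0 < n"
  shows "expected_max n (hard_distr n) \<le> 3"
proof -
  interpret prob_space "iid_values n (hard_distr n)" by (rule prob_space_iid_hard)
  show ?thesis unfolding expected_max_def
    using integrable_Max_iid_hard[OF assms] AE_Max_iid_hard[OF assms]
    by (intro integral_le_const) (auto elim: eventually_mono)
qed

section \<open>Samples with one or two nonzero values\<close>

definition single :: "nat \<Rightarrow> nat \<Rightarrow> real \<Rightarrow> nat \<Rightarrow> real" where
  "single n i a = (\<lambda>k\<in>{..<n}. if k = i then a else 0)"

definition double :: "nat \<Rightarrow> nat \<Rightarrow> nat \<Rightarrow> real \<Rightarrow> nat \<Rightarrow> real" where
  "double n i j a = (\<lambda>k\<in>{..<n}. if k = i then a else if k = j then 2 else 0)"

lemma single_PiE [simp]: "single n i a \<in> {..<n} \<rightarrow>\<^sub>E UNIV"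
  and double_PiE [simp]: "double n i j a \<in> {..<n} \<rightarrow>\<^sub>E UNIV"
  by (auto simp: single_def double_def)

lemma measure_single:
  assumes "i < n" "3 \<le> n"
  shows "measure (iid_values n (hard_distr n)) {single n i 1} =
    1 / real n * (1 - 3 / real n) ^ (n - 1)"
proof -
  have "measure (iid_values n (hard_distr n)) {single n i 1} =
    (\<Prod>k<n. measure (hard_distr n) {single n i 1 k})"
    by (intro measure_iid_hard_singleton) simp
  also have "\<dots> = measure (hard_distr n) {single n i 1 i} *
      (\<Prod>k\<in>{..<n} - {i}. measure (hard_distr n) {single n i 1 k})"
    using assms by (intro prod.remove) auto
  also have "(\<Prod>k\<in>{..<n} - {i}. measure (hard_distr n) {single n i 1 k}) =
      (\<Prod>k\<in>{..<n} - {i}. 1 - 3 / real n)"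
    using assms by (intro prod.cong) (auto simp: single_def measure_hard_distr)
  finally have "measure (iid_values n (hard_distr n)) {single n i 1} =
      measure (hard_distr n) {single n i 1 i} * (\<Prod>k\<in>{..<n} - {i}. 1 - 3 / real n)" .
  moreover have "single n i 1 i = 1" using assms by (simp add: single_def)
  ultimately show ?thesis using assms by (simp add: measure_hard_distr)
qed

lemma measure_double:
  assumes "i < n" "j < n" "i \<noteq> j" "3 \<le> n" "a \<in> {1, 3}"
  shows "measure (iid_values n (hard_distr n)) {double n i j a} =
    (1 / real n)\<^sup>2 * (1 - 3 / real n) ^ (n - 2)"
proof -
  have "measure (iid_values n (hard_distr n)) {double n i j a} =
    (\<Prod>k<n. measure (hard_distr n) {double n i j a k})"
    by (intro measure_iid_hard_singleton) simp
  also have "\<dots> = measure (hard_distr n) {double n i j a i} *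
      (\<Prod>k\<in>{..<n} - {i}. measure (hard_distr n) {double n i j a k})"
    using assms by (intro prod.remove) auto
  also have "(\<Prod>k\<in>{..<n} - {i}. measure (hard_distr n) {double n i j a k}) =
      measure (hard_distr n) {double n i j a j} *
      (\<Prod>k\<in>{..<n} - {i} - {j}. measure (hard_distr n) {double n i j a k})"
    using assms by (intro prod.remove) auto
  also have "(\<Prod>k\<in>{..<n} - {i} - {j}. measure (hard_distr n) {double n i j a k}) =
      (\<Prod>k\<in>{..<n} - {i} - {j}. 1 - 3 / real n)"
    using assms by (intro prod.cong) (auto simp: double_def measure_hard_distr)
  also have "\<dots> = (1 - 3 / real n) ^ (n - 2)"
    using assms by (simp add: card_Diff_singleton numeral_2_eq_2)
  finally have "measure (iid_values n (hard_distr n)) {double n i j a} =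
      measure (hard_distr n) {double n i j a i} * (measure (hard_distr n) {double n i j a j} *
        (1 - 3 / real n) ^ (n - 2))" .
  moreover have "measure (hard_distr n) {double n i j a i} = 1 / real n"
    using assms by (intro measure_hard_distr) (auto simp: double_def)
  moreover have "measure (hard_distr n) {double n i j a j} = 1 / real n"
    using assms by (intro measure_hard_distr) (auto simp: double_def)
  ultimately show ?thesis by (simp only: power2_eq_square mult.assoc)
qed

lemma measure_iid_hard_finite:
  assumes "finite B" "B \<subseteq> {..<n} \<rightarrow>\<^sub>E UNIV"
    and "\<And>c. c \<in> B \<Longrightarrow> measure (iid_values n (hard_distr n)) {c} = p"
  shows "measure (iid_values n (hard_distr n)) B = real (card B) * p"
proof -
  interpret prob_space "iid_values n (hard_distr n)" by (rule prob_space_iid_hard)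
  have "prob B = (\<Sum>c\<in>B. prob {c})"
    using assms by (intro finite_measure_eq_sum_singleton sets_iid_hard_singleton) auto
  then show ?thesis using assms(3) by simp
qed

lemma inj_on_single: "inj_on (\<lambda>i. single n i 1) {..<n}"
proof (rule inj_onI)
  fix i i' assume "i \<in> {..<n}" "i' \<in> {..<n}" "single n i 1 = single n i' 1"
  then show "i = i'" by (auto simp: single_def dest!: fun_cong[of _ _ i] split: if_splits)
qed

text \<open>Since \<open>a\<close> avoids 2, the position of the value 2 reveals \<open>j\<close>,
  and the support then reveals \<open>i\<close>. The value \<open>a i j\<close> may vary with the
  pair because it will be chosen against the algorithm.\<close>

lemma inj_on_double:
  assumes "\<And>i j. a i j \<in> {1, 3}"
  shows "inj_on (\<lambda>(i, j). double n i j (a i j)) {(i, j). i < j \<and> j < n}"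
proof (rule inj_onI, clarify)
  fix i j i' j' assume *: "i < j" "j < n" "i' < j'" "j' < n"
    "double n i j (a i j) = double n i' j' (a i' j')"
  have two: "double n k l (a k l) r = 2 \<longleftrightarrow> r = l"
    and nonzero: "double n k l (a k l) r \<noteq> 0 \<longleftrightarrow> r = k \<or> r = l"
    if "k < l" "r < n" for k l r
    using assms[of k l] that by (auto simp: double_def)
  have "j = j'" using two[of i j j] two[of i' j' j] * by simp
  moreover have "i = i' \<or> i = j'" using nonzero[of i j i] nonzero[of i' j' i] * by simp
  ultimately show "i = i' \<and> j = j'" using *(1) by simp
qed

text \<open>Bernoulli's inequality bounds the \<open>m\<close>-th power below by 1 - 3/4; the fourth
  power of this is 1/256.\<close>

lemma four_mult_power_ge:
  assumes "1 \<le> m"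
  shows "(1 - 3 / real (4 * m)) ^ (4 * m) \<ge> 1 / 256"
proof -
  have "1 / 4 \<le> (1 - 3 / real (4 * m)) ^ m"
    using Bernoulli_inequality[of "- (3 / real (4 * m))" m] assms by (simp add: field_simps)
  then have "(1 / 4) ^ 4 \<le> ((1 - 3 / real (4 * m)) ^ m) ^ 4"
    by (rule power_mono) simp
  then show ?thesis by (simp add: power_mult[symmetric] mult.commute power_divide)
qed

section \<open>Loss for a fixed seed\<close>

lemma loss_set:
  fixes A :: "'r testing_algorithm"
  assumes m: "1 \<le> m" and n: "n = 4 * m"
    and choice_less: "\<And>h. length h = n \<Longrightarrow> choice A s h < n"
  obtains B where "finite B" "B \<subseteq> {..<n} \<rightarrow>\<^sub>E UNIV"
    "measure (iid_values n (hard_distr n)) B \<ge> 1 / 2048"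
    "\<And>x. x \<in> B \<Longrightarrow> \<exists>i<n. x i \<ge> x (chosen_box A n s x) + 1"
proof -
  define z where "z = single n 0 0"
  define t where "t = (\<lambda>i. threshold A s (outcomes A s z i))"
  \<comment> \<open>These are the boxes of the first half where, after only negative feedback from
    zeros or whatever feedback zeros produce, the test separates 0 from 1. As
    \<open>t i \<le> 1\<close>, it is then positive for both 1 and 3.\<close>
  define G where "G = {i \<in> {..<2 * m}. 0 < t i \<and> t i \<le> 1}"
  define q where "q = 1 - 3 / real n"
  have q: "0 \<le> q" "q \<le> 1" "q ^ n \<ge> 1 / 256"
    using m n four_mult_power_ge[OF m] by (auto simp: q_def field_simps)
  have qpow: "q ^ k \<ge> 1 / 256" if "k \<le> n" for k
    using power_decreasing[OF that q(1,2)] q(3) by linarith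
  have n3: "3 \<le> n" using m n by simp
  have z: "z k = 0" if "k < n" for k using that by (simp add: z_def single_def)
  have chosen_less: "chosen_box A n s x < n" for x
    unfolding chosen_box_def by (rule choice_less) simp
  have G: "G \<subseteq> {..<2 * m}" "finite G" by (auto simp: G_def)
  show thesis
  proof (cases "m \<le> card G")
    case True
    \<comment> \<open>Before box \<open>i\<close> both runs see zeros, so box \<open>i\<close> is
      tested at \<open>t i\<close>, where 1 and 3 both give a positive result. All other boxes hold
      equal values.\<close>
    have same: "chosen_box A n s (double n i j 1) = chosen_box A n s (double n i j 3)"
      if "i \<in> G" "i < j" "j < n" for i j
    proof -
      have "outcomes A s (double n i j 1) i = outcomes A s z i"
        using that by (intro outcomes_cong) (auto simp: double_def z)
      then have ti: "threshold A s (outcomes A s (double n i j 1) i) = t i" by (simp add: t_def)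
      have "outcomes A s (double n i j 1) n = outcomes A s (double n i j 3) n"
      proof (rule outcomes_cong)
        fix k assume "k < n"
        show "threshold A s (outcomes A s (double n i j 1) k) \<le> double n i j 1 k \<longleftrightarrow>
          threshold A s (outcomes A s (double n i j 1) k) \<le> double n i j 3 k"
        proof (cases "k = i")
          case True
          then show ?thesis using ti that \<open>k < n\<close> by (simp add: double_def G_def)
        qed (simp add: double_def)
      qed
      then show ?thesis by (simp add: chosen_box_def)
    qed
    \<comment> \<open>The value in box \<open>i\<close> is set against the common choice: if box
      \<open>i\<close> is chosen, it holds 1 and box \<open>j\<close> with 2 is better; otherwise it
      holds 3 and every other box holds at most 2.\<close>
    define a :: "nat \<Rightarrow> nat \<Rightarrow> real" where
      "a = (\<lambda>i j. if chosen_box A n s (double n i j 1) = i then 1 else 3)"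
    \<comment> \<open>Taking \<open>j\<close> from the second half ensures \<open>i < j\<close> and
      leaves \<open>2 * m\<close> partners for each \<open>i\<close>.\<close>
    define S where "S = G \<times> {2 * m..<n}"
    define B where "B = (\<lambda>(i, j). double n i j (a i j)) ` S"
    have S: "S \<subseteq> {(i, j). i < j \<and> j < n}" using G by (auto simp: S_def)
    have a: "a i j \<in> {1, 3}" for i j by (simp add: a_def)
    have "card B = card S"
      unfolding B_def by (intro card_image inj_on_subset[OF inj_on_double S] a)
    moreover have "n - 2 * m = 2 * m" by (simp add: n)
    ultimately have card: "card B = card G * (2 * m)" by (simp add: S_def card_cartesian_product)
    show thesis
    proof
      show fin: "finite B" using G by (simp add: B_def S_def)
      show sub: "B \<subseteq> {..<n} \<rightarrow>\<^sub>E UNIV"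
        unfolding B_def by (intro image_subsetI) (simp only: split_beta double_PiE)
      have "measure (iid_values n (hard_distr n)) B =
          real (card B) * ((1 / real n)\<^sup>2 * q ^ (n - 2))"
        using S a n3 unfolding q_def
        by (intro measure_iid_hard_finite fin sub) (auto simp: B_def intro!: measure_double)
      also have "\<dots> \<ge> real (m * (2 * m)) * ((1 / real n)\<^sup>2 * (1 / 256))"
        unfolding card using True q
        by (intro mult_mono qpow of_nat_mono mult_le_mono1) (auto intro!: mult_nonneg_nonneg)
      \<comment> \<open>With \<open>n = 4 * m\<close>, the fraction of pairs is 2/16 = 1/8, and 1/8
        * 1/256 = 1/2048.\<close>
      also have "real (m * (2 * m)) * ((1 / real n)\<^sup>2 * (1 / 256)) = 1 / 2048"
        using m by (simp add: n power2_eq_square field_simps)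
      finally show "measure (iid_values n (hard_distr n)) B \<ge> 1 / 2048" .
      fix x assume "x \<in> B"
      then obtain i j where ij: "i \<in> G" "i < j" "j < n" "x = double n i j (a i j)"
        using S by (auto simp: B_def S_def)
      show "\<exists>i<n. x i \<ge> x (chosen_box A n s x) + 1"
      proof (cases "chosen_box A n s (double n i j 1) = i")
        case True
        then show ?thesis using ij by (intro exI[of _ j]) (auto simp: a_def double_def)
      next
        case False
        then have "chosen_box A n s x \<noteq> i" using ij same by (simp add: a_def)
        then show ?thesis using ij False chosen_less[of x]
          by (intro exI[of _ i]) (auto simp: a_def double_def)
      qed
    qed
  next
    case False
    \<comment> \<open>Outside \<open>G\<close> either \<open>t i \<le> 0\<close> or
      \<open>t i > 1\<close>, so 0 and 1 give the same result in box \<open>i\<close>. The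
      congruence starts from \<open>z\<close> because \<open>t\<close> is defined along its
      run.\<close>
    have same: "chosen_box A n s (single n i 1) = chosen_box A n s z"
      if "i \<in> {..<2 * m} - G" for i
    proof -
      have "outcomes A s z n = outcomes A s (single n i 1) n"
      proof (rule outcomes_cong)
        fix k assume "k < n"
        then show "threshold A s (outcomes A s z k) \<le> z k \<longleftrightarrow>
            threshold A s (outcomes A s z k) \<le> single n i 1 k"
          using that by (auto simp: single_def z G_def t_def)
      qed
      then show ?thesis by (simp add: chosen_box_def)
    qed
    \<comment> \<open>The box chosen on \<open>z\<close> is removed, since a 1 placed there would be
      found by luck.\<close>
    define S where "S = {..<2 * m} - G - {chosen_box A n s z}"
    define B where "B = (\<lambda>i. single n i 1) ` S"
    have S: "S \<subseteq> {..<n}" "finite S" by (auto simp: S_def n)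
    have "card ({..<2 * m} - G) = 2 * m - card G" using G by (simp add: card_Diff_subset)
    \<comment> \<open>Here \<open>card G < m\<close>, so the complement has at least
      \<open>m + 1\<close> boxes and can spare one.\<close>
    then have "m \<le> card S" using False unfolding S_def card_Diff_singleton_if by auto
    moreover have "card B = card S"
      unfolding B_def by (intro card_image inj_on_subset[OF inj_on_single S(1)])
    ultimately have card: "m \<le> card B" by simp
    show thesis
    proof
      show fin: "finite B" using S by (simp add: B_def)
      show sub: "B \<subseteq> {..<n} \<rightarrow>\<^sub>E UNIV"
        unfolding B_def by (intro image_subsetI single_PiE)
      have "measure (iid_values n (hard_distr n)) B =
          real (card B) * (1 / real n * q ^ (n - 1))"
        using S n3 unfolding q_def
        by (intro measure_iid_hard_finite fin sub) (auto simp: B_def subset_eq measure_single)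
      also have "\<dots> \<ge> real m * (1 / real n * (1 / 256))"
        using card q by (intro mult_mono qpow) (auto intro!: mult_nonneg_nonneg)
      also have "real m * (1 / real n * (1 / 256)) = 1 / 1024"
        using m by (simp add: n)
      finally show "measure (iid_values n (hard_distr n)) B \<ge> 1 / 2048" by simp
      fix x assume "x \<in> B"
      then obtain i where i: "i \<in> S" "x = single n i 1" by (auto simp: B_def)
      then have "chosen_box A n s x \<noteq> i" "i < n" using same S by (auto simp: S_def)
      then show "\<exists>i<n. x i \<ge> x (chosen_box A n s x) + 1" using i chosen_less[of x]
        by (intro exI[of _ i]) (auto simp: single_def)
    qed
  qed
qed

section \<open>From the loss set to expectations\<close>

text \<open>The indicator of the loss set plus the reward is at most the maximum pointwise;
  integrating gives the second bound. The first serves the case of a nonintegrable reward and shows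
  that the expected maximum is positive.\<close>

lemma integral_loss:
  assumes m: "1 \<le> m" and n: "n = 4 * m"
    and choice_less: "\<And>h. length h = n \<Longrightarrow> choice A s h < n"
  shows "expected_max n (hard_distr n) \<ge> 1 / 2048"
    and "integrable (iid_values n (hard_distr n)) (\<lambda>x. x (chosen_box A n s x)) \<Longrightarrow>
      (LINT x|iid_values n (hard_distr n). x (chosen_box A n s x)) \<le>
        expected_max n (hard_distr n) - 1 / 2048"
proof -
  let ?M = "iid_values n (hard_distr n)"
  interpret prob_space ?M by (rule prob_space_iid_hard)
  obtain B where B: "finite B" "B \<subseteq> {..<n} \<rightarrow>\<^sub>E UNIV" "prob B \<ge> 1 / 2048"
    and loss: "\<And>x. x \<in> B \<Longrightarrow> \<exists>i<n. x i \<ge> x (chosen_box A n s x) + 1"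
    using loss_set[OF assms] by metis
  have n0: "0 < n" using m n by simp
  have chosen_less: "chosen_box A n s x < n" for x
    unfolding chosen_box_def by (rule choice_less) simp
  have "(\<Union>c\<in>B. {c}) \<in> sets ?M"
    using B by (intro sets.finite_UN sets_iid_hard_singleton) auto
  then have sets_B: "B \<in> sets ?M" by simp
  have int_B: "integrable ?M (indicator B :: _ \<Rightarrow> real)"
    using sets_B by (intro integrable_real_indicator) (auto simp: less_top[symmetric])
  have Max: "indicator B x + x (chosen_box A n s x) \<le> Max (x ` {..<n})" for x
  proof -
    have ge: "x i \<le> Max (x ` {..<n})" if "i < n" for i using that by (intro Max_ge) auto
    show ?thesis
    proof (cases "x \<in> B")
      case True
      with loss obtain i where "i < n" "x i \<ge> x (chosen_box A n s x) + 1" by blast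
      then have "x (chosen_box A n s x) + 1 \<le> Max (x ` {..<n})"
        using ge[of i] by linarith
      moreover have "indicator B x = (1 :: real)" using True by simp
      ultimately show ?thesis by linarith
    qed (simp add: ge chosen_less)
  qed
  have integral_B: "prob B = (LINT x|?M. indicator B x)" using B(2) by (simp add: Int_absorb2)
  also have "\<dots> \<le> (LINT x|?M. Max (x ` {..<n}))"
  proof (rule integral_mono_AE[OF int_B integrable_Max_iid_hard[OF n0]])
    show "AE x in ?M. indicator B x \<le> Max (x ` {..<n})"
      using AE_iid_hard
    proof eventually_elim
      case (elim x)
      then show ?case using Max[of x] chosen_less[of x] by smt
    qed
  qed
  finally show "expected_max n (hard_distr n) \<ge> 1 / 2048" using B by (simp add: expected_max_def)
  assume int: "integrable ?M (\<lambda>x. x (chosen_box A n s x))"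
  have "prob B + (LINT x|?M. x (chosen_box A n s x)) =
      (LINT x|?M. indicator B x + x (chosen_box A n s x))"
    unfolding integral_B using int int_B
    by (rule Bochner_Integration.integral_add[symmetric, rotated])
  also have "\<dots> \<le> expected_max n (hard_distr n)"
    unfolding expected_max_def using int int_B
    by (intro integral_mono integrable_Max_iid_hard n0 Max) auto
  finally show "(LINT x|?M. x (chosen_box A n s x)) \<le> expected_max n (hard_distr n) - 1 / 2048"
    using B by simp
qed

section \<open>Averaging over the seed and contradiction\<close>

text \<open>
  The reward need not be shown to be measurable in seed and values jointly: were it not integrable,
  the expected reward would be the junk value 0, which also satisfies the bound.
\<close>

lemma expected_reward_hard_le:
  assumes A: "is_testing_algorithm n A" and m: "1 \<le> m" and n: "n = 4 * m"
  shows "expected_reward n (hard_distr n) A \<le> expected_max n (hard_distr n) - 1 / 2048"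
proof -
  let ?M = "iid_values n (hard_distr n)"
  let ?f = "\<lambda>(s, x). x (chosen_box A n s x)"
  interpret S: prob_space "seed_space A" using A by (simp add: is_testing_algorithm_def)
  interpret M: prob_space ?M by (rule prob_space_iid_hard)
  interpret pair_sigma_finite "seed_space A" ?M ..
  show ?thesis
  proof (cases "integrable (seed_space A \<Otimes>\<^sub>M ?M) ?f")
    case True
    \<comment> \<open>By Fubini almost every seed has an integrable section, to which the bound for
      a fixed seed applies.\<close>
    from AE_integrable_fst'[OF this]
    have "AE s in seed_space A. integrable ?M (\<lambda>x. x (chosen_box A n s x))"
      by (simp only: prod.case)
    from this AE_space have "AE s in seed_space A.
        (LINT x|?M. ?f (s, x)) \<le> expected_max n (hard_distr n) - 1 / 2048"
      proof eventually_elim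
      case (elim s)
      have "choice A s h < n" if "length h = n" for h
        using choice_less[OF A elim(2) that] .
      then show ?case using integral_loss(2)[OF m n, of A s] elim(1) by simp
    qed
    then have "(LINT s|seed_space A. LINT x|?M. ?f (s, x)) \<le>
        expected_max n (hard_distr n) - 1 / 2048"
      using integrable_fst'[OF True] by (intro S.integral_le_const)
    then show ?thesis using integral_fst'[OF True] by (simp add: expected_reward_def)
  next
    case False
    \<comment> \<open>The reward is now 0, so the expected maximum must be at least 1/2048. That
      bound is stated for a run with some seed, and any seed will do.\<close>
    obtain s where s: "s \<in> space (seed_space A)" using S.not_empty by auto
    have "expected_max n (hard_distr n) \<ge> 1 / 2048"
      by (rule integral_loss(1)[OF m n]) (rule choice_less[OF A s])
    then show ?thesis
      using not_integrable_integral_eq[OF False] by (simp add: expected_reward_def)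
  qed
qed

theorem theorem8:
  "\<not> (\<exists>(alg :: nat \<Rightarrow> real measure \<Rightarrow> 'r testing_algorithm) (\<epsilon> :: nat \<Rightarrow> real).
        \<epsilon> \<longlonglongrightarrow> 0 \<and>
        (\<forall>n\<ge>1. \<forall>F. nonneg_distribution F \<longrightarrow>
           is_testing_algorithm n (alg n F) \<and> competitive (1 - \<epsilon> n) n F (alg n F)))"
proof clarify
  fix alg :: "nat \<Rightarrow> real measure \<Rightarrow> 'r testing_algorithm" and \<epsilon> :: "nat \<Rightarrow> real"
  assume lim: "\<epsilon> \<longlonglongrightarrow> 0" and alg: "\<forall>n\<ge>1. \<forall>F. nonneg_distribution F \<longrightarrow>
    is_testing_algorithm n (alg n F) \<and> competitive (1 - \<epsilon> n) n F (alg n F)"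
  \<comment> \<open>The constant is 1/2048 divided by 3, the upper bound on the expected
    maximum.\<close>
  from lim have "\<forall>\<^sub>F n in sequentially. \<epsilon> n < 1 / 6144"
    by (rule order_tendstoD) simp
  then obtain N where N: "\<And>n. n \<ge> N \<Longrightarrow> \<epsilon> n < 1 / 6144"
    by (auto simp: eventually_sequentially)
  define m where "m = Suc N"
  define n where "n = 4 * m"
  define E where "E = expected_max n (hard_distr n)"
  have m: "1 \<le> m" and n: "1 \<le> n" and \<epsilon>: "\<epsilon> n < 1 / 6144"
    using N[of n] by (auto simp: m_def n_def)
  let ?A = "alg n (hard_distr n)"
  have A: "is_testing_algorithm n ?A" "competitive (1 - \<epsilon> n) n (hard_distr n) ?A"
    using alg n nonneg_distribution_hard_distr by blast+
  have "(1 - \<epsilon> n) * E \<le> E - 1 / 2048"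
    using expected_reward_hard_le[OF A(1) m n_def] A(2) by (simp add: competitive_def E_def)
  then have "1 / 2048 \<le> \<epsilon> n * E" by (simp add: algebra_simps)
  \<comment> \<open>Positivity keeps the inequality strict when
    \<open>\<epsilon> n < 1 / 6144\<close> is multiplied by \<open>E\<close>; with
    \<open>E \<le> 3\<close> the product stays below 1/2048.\<close>
  moreover have E: "0 < E" "E \<le> 3"
  proof -
    show "E \<le> 3" unfolding E_def using n by (intro expected_max_hard_le) simp
    interpret S: prob_space "seed_space ?A" using A(1) by (simp add: is_testing_algorithm_def)
    obtain s where "s \<in> space (seed_space ?A)" using S.not_empty by auto
    from integral_loss(1)[OF m n_def choice_less[OF A(1) this]] show "0 < E" by (simp add: E_def)
  qed
  moreover have "\<epsilon> n * E < 1 / 6144 * E"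
    using \<epsilon> E(1) by (rule mult_strict_right_mono)
  ultimately show False by simp
qed

end
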